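(* Let $p\ge 1$, let $f:\mathbb{R}^p\to[0,\infty)$ and $r:\mathbb{R}^p\to\mathbb{R}$, and put $F=f+r$. Assume: (A1) $f$ is of class $C^{1,1}$ with $\|\nabla f(u)-\nabla f(v)\|\le L_f\|u-v\|$ for all $u,v\in\mathbb{R}^p$, for some $L_f>0$. (A2) $F$ is lower semi-continuous and coercive (i.e. $F(w)\to\infty$ as $\|w\|\to\infty$), and $\inf_{w\in\mathbb{R}^p}F(w)>-\infty$. (A3) $r(w)=\sum_{i=1}^p\zeta(|w_i|)$, where $\zeta:[0,\infty)\to[0,\infty)$ is concave and differentiable and $|\zeta'(t_1)-\zeta'(t_2)|\le L_\zeta|t_1-t_2|$ for all $t_1,t_2\ge0$. (A4) $(w^{(k)})_{k\ge0}$ is a sequence in $\mathbb{R}^p$ with arbitrary starting point $w^{(0)}$, and for each $k\ge 0$ there is a surrogate $Q_f(\cdot\,|\,w^{(k)}):\mathbb{R}^p\to\mathbb{R}$ such that $Q_f(w|w^{(k)})\ge f(w)$ for all $w$ and $Q_f(w^{(k)}|w^{(k)})=f(w^{(k)})$; the function $w\mapsto Q_f(w|w^{(k)})-f(w)$ is $\gamma$-strongly convex; $w\mapsto Q_f(w|w^{(k)})$ is differentiable with $L_{Q_f}$-Lipschitz continuous gradient; and $\nabla Q_f(w^{(k)}|w^{(k)})=\nabla f(w^{(k)})$. Here $\gamma>0$ and $L_{Q_f}$ do not depend on $k$. (A5) The sequence is generated by one of the following two schemes: either for all $k\ge0$ $$w^{(k+1)}\in\operatorname{argmin}_{w}\{Q_f(w|w^{(k)})+r(w)\},$$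 or for all $k\ge0$ $$w^{(k+1)}\in\operatorname{argmin}_{w}\{Q_f(w|w^{(k)})+Q_r(w|w^{(k)})\},$$ where $$Q_r(w|w^{(k)})=\sum_{i=1}^p\big[\zeta(|w_i^{(k)}|)+\zeta'(|w_i^{(k)}|)(|w_i|-|w_i^{(k)}|)\big].$$ (A6) $F$ has the Kurdyka-Łojasiewicz property at each point of $\operatorname{dom}\partial F$. Then: (i) The sequence has finite length: $\sum_{k=0}^\infty\|w^{(k+1)}-w^{(k)}\|<\infty$. (ii) The sequence $(w^{(k)})$ converges to a critical point $w^*$ of $F$.
   Context: $\|\cdot\|$ is the Euclidean norm. At $0$, $\zeta'(0)$ is the right derivative of $\zeta$. For a proper lower semi-continuous $F:\mathbb{R}^p\to(-\infty,+\infty]$ and $x\in\operatorname{dom}F=\{x:F(x)<+\infty\}$, the Fréchet subdifferential $\hat\partial F(x)$ is the set of $u\in\mathbb{R}^p$ with $\liminf_{y\to x,\,y\ne x}\frac{F(y)-F(x)-u^T(y-x)}{\|y-x\|}\ge0$; for $x\notin\operatorname{dom}F$ it is empty. The limiting subdifferential is $\partial F(x)=\{u:\exists\,x_k\to x,\ F(x_k)\to F(x),\ u_k\in\hat\partial F(x_k),\ u_k\to u\}$. Let $\operatorname{dom}\partial F=\{x:\partial F(x)\neq\emptyset\}$. A point $x^*$ is a critical point of $F$ if $0\in\partial F(x^* )$. A proper lower semi-continuous $F$ has the Kurdyka-Łojasiewicz property at $\bar u\in\operatorname{dom}\partial F$ if there exist $\eta\in(0,+\infty]$, a neighborhood $\mathcal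 U$ of $\bar u$, and a continuous concave function $\phi:[0,\eta)\to[0,\infty)$ with $\phi(0)=0$, $\phi$ of class $C^1$ on $(0,\eta)$, and $\phi'(t)>0$ for all $t\in(0,\eta)$, such that for all $u\in\mathcal U$ with $F(\bar u)<F(u)<F(\bar u)+\eta$, $$\phi'(F(u)-F(\bar u))\,\operatorname{dist}(0,\partial F(u))\ge1,$$ where $\operatorname{dist}(u,A)=\inf_{v\in A}\|u-v\|$. *)

theory Defs
  imports "HOL-Analysis.Analysis"
begin

definition proper_fun :: "('a \<Rightarrow> ereal) \<Rightarrow> bool" where
  "proper_fun F \<longleftrightarrow> (\<forall>x. F x \<noteq> -\<infinity>) \<and> (\<exists>x. F x < \<infinity>)"

definition lower_semicontinuous :: "('a::topological_space \<Rightarrow> ereal) \<Rightarrow> bool" where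
  "lower_semicontinuous F \<longleftrightarrow> (\<forall>x. F x \<le> Liminf (at x) F)"

definition frechet_subdiff :: "('a::real_inner \<Rightarrow> ereal) \<Rightarrow> 'a \<Rightarrow> 'a set" where
  "frechet_subdiff F x =
     {u. F x < \<infinity> \<and>
         0 \<le> Liminf (at x) (\<lambda>y. (F y - F x - ereal (u \<bullet> (y - x))) / ereal (norm (y - x)))}"

(* As usual, the limiting subdifferential is empty outside the effective domain. *)
definition limiting_subdiff :: "('a::real_inner \<Rightarrow> ereal) \<Rightarrow> 'a \<Rightarrow> 'a set" where
  "limiting_subdiff F x =
     {u. F x < \<infinity> \<and>
         (\<exists>X U. X \<longlonglongrightarrow> x \<and> (\<lambda>k. F (X k)) \<longlonglongrightarrow> F x \<and>
                (\<forall>k::nat. U k \<in> frechet_subdiff F (X k)) \<and> U \<longlonglongrightarrow> u)}"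

definition dom_subdiff :: "('a::real_inner \<Rightarrow> ereal) \<Rightarrow> 'a set" where
  "dom_subdiff F = {x. limiting_subdiff F x \<noteq> {}}"

definition critical_point :: "('a::real_inner \<Rightarrow> ereal) \<Rightarrow> 'a \<Rightarrow> bool" where
  "critical_point F x \<longleftrightarrow> 0 \<in> limiting_subdiff F x"

(* Unlike infdist, this is infinite when A is empty, so that the Kurdyka-Lojasiewicz
   inequality holds at points with empty subdifferential. *)
definition edist_to :: "'a::real_normed_vector \<Rightarrow> 'a set \<Rightarrow> ereal" where
  "edist_to u A = (INF v\<in>A. ereal (norm (u - v)))"

(* phi is a total function, constrained only on [0, eta); phi' is its derivative on (0, eta). *)
definition desingularizing :: "ereal \<Rightarrow> (real \<Rightarrow> real) \<Rightarrow> (real \<Rightarrow> real) \<Rightarrow> bool" where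
  "desingularizing \<eta> \<phi> \<phi>' \<longleftrightarrow>
     continuous_on {t. 0 \<le> t \<and> ereal t < \<eta>} \<phi> \<and>
     concave_on {t. 0 \<le> t \<and> ereal t < \<eta>} \<phi> \<and>
     (\<forall>t. 0 \<le> t \<and> ereal t < \<eta> \<longrightarrow> 0 \<le> \<phi> t) \<and>
     \<phi> 0 = 0 \<and>
     (\<forall>t. 0 < t \<and> ereal t < \<eta> \<longrightarrow> (\<phi> has_real_derivative \<phi>' t) (at t)) \<and>
     continuous_on {t. 0 < t \<and> ereal t < \<eta>} \<phi>' \<and>
     (\<forall>t. 0 < t \<and> ereal t < \<eta> \<longrightarrow> 0 < \<phi>' t)"

(* The argument of real_of_ereal below is always finite: F ubar < F u < F ubar + eta. *)
definition KL_property_at :: "('a::real_inner \<Rightarrow> ereal) \<Rightarrow> 'a \<Rightarrow> bool" where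
  "KL_property_at F ubar \<longleftrightarrow>
     proper_fun F \<and> lower_semicontinuous F \<and> ubar \<in> dom_subdiff F \<and>
     (\<exists>\<eta>::ereal. \<exists>N \<phi> \<phi>'. 0 < \<eta> \<and> open N \<and> ubar \<in> N \<and> desingularizing \<eta> \<phi> \<phi>' \<and>
        (\<forall>u\<in>N. F ubar < F u \<and> F u < F ubar + \<eta> \<longrightarrow>
           1 \<le> ereal (\<phi>' (real_of_ereal (F u - F ubar))) * edist_to 0 (limiting_subdiff F u)))"

definition strongly_convex :: "real \<Rightarrow> ('a::real_normed_vector \<Rightarrow> real) \<Rightarrow> bool" where
  "strongly_convex \<gamma> h \<longleftrightarrow>
     (\<forall>x y. \<forall>t\<in>{0..1}. h (t *\<^sub>R x + (1 - t) *\<^sub>R y)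
        \<le> t * h x + (1 - t) * h y - \<gamma> / 2 * t * (1 - t) * (norm (x - y))\<^sup>2)"

(* Separable majorizer at v: each zeta is linearised at |v_i|, with zeta' its derivative. *)
definition linearized_reg ::
  "(real \<Rightarrow> real) \<Rightarrow> (real \<Rightarrow> real) \<Rightarrow> real ^ 'n \<Rightarrow> real ^ 'n \<Rightarrow> real" where
  "linearized_reg \<zeta> \<zeta>' v w =
     (\<Sum>i\<in>UNIV. \<zeta> \<bar>v $ i\<bar> + \<zeta>' \<bar>v $ i\<bar> * (\<bar>w $ i\<bar> - \<bar>v $ i\<bar>))"

end

theory Submission
  imports Defs
begin

text \<open>
  Both schemes choose the next iterate as a minimiser of a majorant \<open>M\<^sub>k\<close> of \<open>F\<close> that touches \<open>F\<close>
  at \<open>w\<^sub>k\<close>: the smooth part is replaced by its surrogate, and the penalty is either kept or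
  linearised, which majorises it because \<open>\<zeta>\<close> is concave. Two estimates follow.

  \<^item> Sufficient decrease. The gap between the surrogate and \<open>f\<close> is strongly convex and minimal at
    \<open>w\<^sub>k\<close>, so it grows quadratically (\<open>strongly_convex_quadratic_growth\<close>), and
    \<open>F(w\<^sub>k\<^sub>+\<^sub>1) + \<gamma>/2 \<parallel>w\<^sub>k\<^sub>+\<^sub>1 - w\<^sub>k\<parallel>\<^sup>2 \<le> M\<^sub>k(w\<^sub>k\<^sub>+\<^sub>1) \<le> M\<^sub>k(w\<^sub>k) = F(w\<^sub>k)\<close>.

  \<^item> Relative error. Write \<open>F = M\<^sub>k + (F - M\<^sub>k)\<close>. At \<open>w\<^sub>k\<^sub>+\<^sub>1\<close> the first summand has the Frechet
    subgradient \<open>0\<close>. The second consists of a differentiable part, whose gradient is Lipschitz and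
    vanishes at \<open>w\<^sub>k\<close>, and of the gap left by the linearisation of the penalty, which has a
    subgradient of norm \<open>O(\<parallel>w\<^sub>k\<^sub>+\<^sub>1 - w\<^sub>k\<parallel>)\<close> (\<open>linearization_gap_subgradient\<close>). Splitting \<open>F\<close> in this
    way avoids solving the optimality conditions of the subproblem coordinate by coordinate.

  The rest (\<open>KL_descent_converges\<close>) is the argument of Attouch, Bolte and Svaiter: coercivity keeps
  the sequence bounded, its cluster points are critical, and near such a point the
  Kurdyka-Lojasiewicz inequality turns the two estimates into a telescoping bound for the length of
  the path, which therefore converges.
\<close>

section \<open>Tangents of concave functions\<close>

text \<open>The derivative is one-sided at an endpoint of \<open>S\<close>. This case is essential below, since \<open>\<zeta>\<close> has to be
linearised at \<open>0\<close>. On the segment from \<open>x\<close> to \<open>y\<close> concavity bounds every difference quotient from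
below by the one for the whole segment, and the quotients tend to the directional derivative.\<close>

lemma concave_on_below_tangent:
  fixes f :: "real \<Rightarrow> real"
  assumes conc: "concave_on S f" and x: "x \<in> S" and y: "y \<in> S"
    and deriv: "(f has_real_derivative D) (at x within S)"
  shows "f y \<le> f x + D * (y - x)"
proof -
  have S: "x + t * (y - x) \<in> S" if "0 \<le> t" "t \<le> 1" for t
    using convexD_alt[OF concave_on_imp_convex[OF conc] x y that] by (simp add: algebra_simps)
  have "((\<lambda>t. x + t * (y - x)) has_real_derivative (y - x)) (at 0 within {0..1})"
    by (auto intro!: derivative_eq_intros)
  moreover have "(f has_real_derivative D) (at (x + 0 * (y - x)) within (\<lambda>t. x + t * (y - x)) ` {0..1})"
    using S by (auto intro!: DERIV_subset[OF deriv])
  ultimately have "(f \<circ> (\<lambda>t. x + t * (y - x)) has_real_derivative D * (y - x)) (at 0 within {0..1})"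
    by (rule DERIV_image_chain[rotated])
  then have lim: "((\<lambda>t. (f (x + t * (y - x)) - f x) / t) \<longlongrightarrow> D * (y - x)) (at 0 within {0..1})"
    by (simp add: has_field_derivative_iff)
  have "f y - f x \<le> (f (x + t * (y - x)) - f x) / t" if "t \<in> {0..1}" "t \<noteq> 0" for t
  proof -
    have "(1 - t) * f x + t * f y \<le> f ((1 - t) *\<^sub>R x + t *\<^sub>R y)"
      using concave_onD[OF conc, of t x y] that x y by auto
    also have "(1 - t) *\<^sub>R x + t *\<^sub>R y = x + t * (y - x)"
      by (simp add: algebra_simps)
    finally show ?thesis using that by (simp add: field_simps)
  qed
  then have "f y - f x \<le> D * (y - x)"
    by (intro tendsto_lowerbound[OF lim])
       (auto simp: eventually_at_filter trivial_limit_within islimpt_Icc)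
  then show ?thesis by simp
qed

section \<open>Calculus of Frechet subgradients\<close>

text \<open>The \<open>\<epsilon>\<close>-form of membership in the Frechet subdifferential for real-valued functions. Filtering
by \<open>nhds x\<close> instead of the punctured \<open>at x\<close> changes nothing, because the inequality is trivial at
\<open>y = x\<close>, but it makes the notion stable under maps such as coordinate projections, which
may send \<open>y \<noteq> x\<close> to the base point.\<close>

definition frechet_subgradient :: "('a::real_inner \<Rightarrow> real) \<Rightarrow> 'a \<Rightarrow> 'a \<Rightarrow> bool" where
  "frechet_subgradient h x u \<longleftrightarrow>
     (\<forall>e>0. \<forall>\<^sub>F y in nhds x. h x + u \<bullet> (y - x) - e * norm (y - x) \<le> h y)"

lemma frechet_subgradient_imp_frechet_subdiff:
  assumes "frechet_subgradient h x u"
  shows "u \<in> frechet_subdiff (\<lambda>x. ereal (h x)) x"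
proof -
  have "\<forall>\<^sub>F y in at x. z < (ereal (h y) - ereal (h x) - ereal (u \<bullet> (y - x))) / ereal (norm (y - x))"
    if z: "z < 0" for z :: ereal
  proof -
    obtain q where q: "z < ereal q" "ereal q < 0"
      using ereal_dense2[OF z] by auto
    have "\<forall>\<^sub>F y in nhds x. h x + u \<bullet> (y - x) - (- q) * norm (y - x) \<le> h y"
      using q(2) by (intro assms[unfolded frechet_subgradient_def, rule_format]) simp
    then have "\<forall>\<^sub>F y in at x. y \<noteq> x \<and> h x + u \<bullet> (y - x) - (- q) * norm (y - x) \<le> h y"
      by (auto simp: eventually_at_filter elim: eventually_mono)
    then show ?thesis
    proof eventually_elim
      case (elim y)
      then have "q \<le> (h y - h x - u \<bullet> (y - x)) / norm (y - x)"
        by (simp add: field_simps)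
      with q(1) elim show ?case
        by (simp add: less_le_trans)
    qed
  qed
  then show ?thesis
    by (auto simp: frechet_subdiff_def le_Liminf_iff)
qed

lemma frechet_subgradient_add:
  assumes "frechet_subgradient g x u" "frechet_subgradient h x v"
  shows "frechet_subgradient (\<lambda>y. g y + h y) x (u + v)"
  unfolding frechet_subgradient_def
proof (intro allI impI)
  fix e :: real assume "e > 0"
  then have "\<forall>\<^sub>F y in nhds x. g x + u \<bullet> (y - x) - e/2 * norm (y - x) \<le> g y"
    "\<forall>\<^sub>F y in nhds x. h x + v \<bullet> (y - x) - e/2 * norm (y - x) \<le> h y"
    using assms[unfolded frechet_subgradient_def, rule_format, of "e/2"] by simp_all
  then show "\<forall>\<^sub>F y in nhds x. g x + h x + (u + v) \<bullet> (y - x) - e * norm (y - x) \<le> g y + h y"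
    by eventually_elim (simp add: inner_add_left)
qed

lemma frechet_subgradient_minimizer:
  assumes "\<And>y. h x \<le> h y"
  shows "frechet_subgradient h x 0"
  unfolding frechet_subgradient_def
proof (intro allI impI always_eventually)
  fix e :: real and y assume "e > 0"
  then have "0 \<le> e * norm (y - x)" by simp
  with assms[of y] show "h x + 0 \<bullet> (y - x) - e * norm (y - x) \<le> h y" by simp
qed

lemma frechet_subgradient_GDERIV:
  assumes "GDERIV h x :> D"
  shows "frechet_subgradient h x D"
  unfolding frechet_subgradient_def
proof (intro allI impI)
  fix e :: real assume "e > 0"
  then obtain d where "d > 0"
    and d: "\<And>y. norm (y - x) < d \<Longrightarrow> norm (h y - h x - (y - x) \<bullet> D) \<le> e * norm (y - x)"
    using assms unfolding gderiv_def has_derivative_at_alt by blast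
  then have "\<forall>\<^sub>F y in nhds x. norm (y - x) < d"
    by (auto simp: eventually_nhds_metric dist_norm)
  then show "\<forall>\<^sub>F y in nhds x. h x + D \<bullet> (y - x) - e * norm (y - x) \<le> h y"
  proof eventually_elim
    case (elim y)
    with d[of y] show ?case by (simp add: inner_commute abs_le_iff)
  qed
qed

text \<open>Each of the \<open>n\<close> coordinates receives the share \<open>e / n\<close> of the error, since
\<open>\<bar>y $ i - x $ i\<bar> \<le> norm (y - x)\<close>.\<close>

lemma frechet_subgradient_separable:
  fixes x v :: "real ^ 'n"
  assumes "\<And>i. frechet_subgradient (g i) (x $ i) (v $ i)"
  shows "frechet_subgradient (\<lambda>y. \<Sum>i\<in>UNIV. g i (y $ i)) x v"
  unfolding frechet_subgradient_def
proof (intro allI impI)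
  fix e :: real assume "e > 0"
  define d where "d = e / real CARD('n)"
  have "d > 0" using \<open>e > 0\<close> by (simp add: d_def)
  have "\<forall>\<^sub>F y in nhds x. g i (x $ i) + (v $ i) \<bullet> (y $ i - x $ i) - d * norm (y $ i - x $ i) \<le> g i (y $ i)"
    for i
  proof -
    have "filterlim (\<lambda>y. y $ i) (nhds (x $ i)) (nhds x)"
      by (intro tendsto_vec_nth filterlim_ident)
    then show ?thesis
      using assms[of i] \<open>d > 0\<close> unfolding frechet_subgradient_def
      by (auto dest: eventually_compose_filterlim)
  qed
  then have "\<forall>\<^sub>F y in nhds x. \<forall>i\<in>UNIV. g i (x $ i) + (v $ i) \<bullet> (y $ i - x $ i) - d * norm (y $ i - x $ i) \<le> g i (y $ i)"
    by (intro eventually_ball_finite) auto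
  then show "\<forall>\<^sub>F y in nhds x. (\<Sum>i\<in>UNIV. g i (x $ i)) + v \<bullet> (y - x) - e * norm (y - x) \<le> (\<Sum>i\<in>UNIV. g i (y $ i))"
  proof eventually_elim
    case (elim y)
    have "(\<Sum>i\<in>UNIV. d * norm (y $ i - x $ i)) \<le> (\<Sum>i\<in>(UNIV :: 'n set). d * norm (y - x))"
      using \<open>d > 0\<close> component_le_norm_cart[of "y - x"] by (intro sum_mono mult_left_mono) auto
    also have "\<dots> = e * norm (y - x)"
      by (simp add: d_def)
    finally have "(\<Sum>i\<in>UNIV. g i (x $ i)) + v \<bullet> (y - x) - e * norm (y - x)
      \<le> (\<Sum>i\<in>UNIV. g i (x $ i) + (v $ i) \<bullet> (y $ i - x $ i) - d * norm (y $ i - x $ i))"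
      by (simp add: inner_vec_def sum.distrib sum_subtractf)
    also have "\<dots> \<le> (\<Sum>i\<in>UNIV. g i (y $ i))"
      using elim by (intro sum_mono) auto
    finally show ?case .
  qed
qed

text \<open>Away from \<open>0\<close> this is the chain rule. At \<open>0\<close> the composition has a kink, and a nonnegative
slope makes it point upwards, so that \<open>0\<close> is a subgradient there; the convention \<open>sgn 0 = 0\<close>
selects exactly this subgradient.\<close>

lemma frechet_subgradient_abs:
  fixes g :: "real \<Rightarrow> real"
  assumes deriv: "(g has_real_derivative D) (at \<bar>x\<bar> within {0..})"
    and kink: "x = 0 \<Longrightarrow> 0 \<le> D"
  shows "frechet_subgradient (\<lambda>y. g \<bar>y\<bar>) x (D * sgn x)"
  unfolding frechet_subgradient_def
proof (intro allI impI)
  fix e :: real assume "e > 0"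
  then obtain d where "d > 0"
    and d: "\<And>s. s \<ge> 0 \<Longrightarrow> norm (s - \<bar>x\<bar>) < d \<Longrightarrow> norm (g s - g \<bar>x\<bar> - D * (s - \<bar>x\<bar>)) \<le> e * norm (s - \<bar>x\<bar>)"
    using deriv unfolding has_field_derivative_def has_derivative_within_alt
    by (metis atLeast_iff)
  \<comment> \<open>the radius \<open>\<bar>x\<bar>\<close> keeps the sign of \<open>y\<close> equal to that of \<open>x\<close>\<close>
  define d' where "d' = (if x = 0 then d else min d \<bar>x\<bar>)"
  have "d' > 0" using \<open>d > 0\<close> by (simp add: d'_def)
  then have "\<forall>\<^sub>F y in nhds x. \<bar>y - x\<bar> < d'"
    by (auto simp: eventually_nhds_metric dist_real_def)
  then show "\<forall>\<^sub>F y in nhds x. g \<bar>x\<bar> + (D * sgn x) \<bullet> (y - x) - e * norm (y - x) \<le> g \<bar>y\<bar>"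
  proof eventually_elim
    case (elim y)
    have "\<bar>\<bar>y\<bar> - \<bar>x\<bar>\<bar> \<le> \<bar>y - x\<bar>" by (rule abs_triangle_ineq3)
    moreover have "\<bar>y - x\<bar> < d" using elim by (auto simp: d'_def split: if_splits)
    ultimately have "norm (g \<bar>y\<bar> - g \<bar>x\<bar> - D * (\<bar>y\<bar> - \<bar>x\<bar>)) \<le> e * norm (\<bar>y\<bar> - \<bar>x\<bar>)"
      by (intro d) auto
    also have "\<dots> \<le> e * \<bar>y - x\<bar>"
      using \<open>e > 0\<close> \<open>\<bar>\<bar>y\<bar> - \<bar>x\<bar>\<bar> \<le> \<bar>y - x\<bar>\<close> by simp
    finally have *: "g \<bar>x\<bar> + D * (\<bar>y\<bar> - \<bar>x\<bar>) - e * \<bar>y - x\<bar> \<le> g \<bar>y\<bar>"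
      by (simp add: abs_le_iff)
    have "D * sgn x * (y - x) \<le> D * (\<bar>y\<bar> - \<bar>x\<bar>)"
    proof (cases "x = 0")
      case True
      with kink show ?thesis by simp
    next
      case False
      with elim have "\<bar>y - x\<bar> < \<bar>x\<bar>" by (simp add: d'_def)
      then have "sgn x * (y - x) = \<bar>y\<bar> - \<bar>x\<bar>"
        by (auto simp: sgn_if split: if_splits)
      then show ?thesis by (simp add: mult.assoc)
    qed
    with * show ?case by simp
  qed
qed

section \<open>Finite length of descent sequences under the Kurdyka-Lojasiewicz property\<close>

text \<open>The form in which the Kurdyka-Lojasiewicz property is used: the distance to the subdifferential
is bounded by the norm of any of its elements, \<open>\<eta>\<close> is decreased to a positive real, and differentiability and concavity of \<open>\<phi>\<close> are
condensed into the tangent inequality. Of continuity only the limit at \<open>0\<close> is kept.\<close>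

lemma KL_property_real:
  fixes F :: "'a::real_inner \<Rightarrow> real"
  assumes "KL_property_at (\<lambda>x. ereal (F x)) x"
  obtains \<rho> \<eta> :: real and \<phi> \<phi>' :: "real \<Rightarrow> real"
  where "\<rho> > 0" "\<eta> > 0" "(\<phi> \<longlongrightarrow> 0) (at_right 0)"
    "\<And>t. 0 < t \<Longrightarrow> t < \<eta> \<Longrightarrow> 0 \<le> \<phi> t"
    "\<And>s t. 0 < s \<Longrightarrow> s < \<eta> \<Longrightarrow> 0 < t \<Longrightarrow> t < \<eta> \<Longrightarrow> \<phi> s \<le> \<phi> t + \<phi>' t * (s - t)"
    "\<And>y v. dist x y < \<rho> \<Longrightarrow> F x < F y \<Longrightarrow> F y < F x + \<eta> \<Longrightarrow>
       v \<in> limiting_subdiff (\<lambda>x. ereal (F x)) y \<Longrightarrow> 1 \<le> \<phi>' (F y - F x) * norm v"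
proof -
  let ?F = "\<lambda>x. ereal (F x)"
  obtain \<eta> :: ereal and N \<phi> \<phi>' where "0 < \<eta>" and N: "open N" "x \<in> N" and "desingularizing \<eta> \<phi> \<phi>'"
    and KL: "\<And>u. u \<in> N \<Longrightarrow> ?F x < ?F u \<Longrightarrow> ?F u < ?F x + \<eta> \<Longrightarrow>
          1 \<le> ereal (\<phi>' (real_of_ereal (?F u - ?F x))) * edist_to 0 (limiting_subdiff ?F u)"
    using assms unfolding KL_property_at_def by blast
  obtain h where h: "0 < ereal h" "ereal h < \<eta>"
    using ereal_dense2[OF \<open>0 < \<eta>\<close>] by blast
  then have "h > 0" by simp
  have lt: "ereal t < \<eta>" if "t < h" for t
    using that h(2) by (meson ereal_less_eq(3) le_less_trans less_imp_le)
  define S where "S = {t. 0 \<le> t \<and> ereal t < \<eta>}"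
  have cont: "continuous_on S \<phi>" and conc: "concave_on S \<phi>" and "\<phi> 0 = 0"
    and nonneg: "\<And>t. t \<in> S \<Longrightarrow> 0 \<le> \<phi> t"
    and deriv: "\<And>t. 0 < t \<Longrightarrow> t \<in> S \<Longrightarrow> (\<phi> has_real_derivative \<phi>' t) (at t)"
    and pos: "\<And>t. 0 < t \<Longrightarrow> t \<in> S \<Longrightarrow> 0 < \<phi>' t"
    using \<open>desingularizing \<eta> \<phi> \<phi>'\<close> unfolding desingularizing_def S_def by auto
  have S: "t \<in> S" if "0 \<le> t" "t < h" for t
    using that lt by (simp add: S_def)
  obtain \<rho> where "\<rho> > 0" and \<rho>: "ball x \<rho> \<subseteq> N"
    using N openE by blast
  show thesis
  proof (rule that[OF \<open>\<rho> > 0\<close> \<open>h > 0\<close>])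
    have "(\<phi> \<longlongrightarrow> 0) (at 0 within S)"
      using cont S[of 0] \<open>h > 0\<close> \<open>\<phi> 0 = 0\<close> by (auto simp: continuous_on)
    moreover have "at 0 within {0<..<h} \<le> at 0 within S"
      using S by (intro at_le) auto
    moreover have "at_right 0 = at 0 within {0<..<h}"
      using \<open>h > 0\<close> by (intro at_within_nhd[of _ "{..<h}"]) auto
    ultimately show "(\<phi> \<longlongrightarrow> 0) (at_right 0)"
      by (simp add: tendsto_mono)
    show "0 \<le> \<phi> t" if "0 < t" "t < h" for t
      using that S nonneg by simp
    show "\<phi> s \<le> \<phi> t + \<phi>' t * (s - t)" if "0 < s" "s < h" "0 < t" "t < h" for s t
      using that S by (auto intro!: concave_on_below_tangent[OF conc] DERIV_subset[OF deriv, of t])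
    show "1 \<le> \<phi>' (F y - F x) * norm v"
      if "dist x y < \<rho>" "F x < F y" "F y < F x + h" and v: "v \<in> limiting_subdiff ?F y" for y v
    proof -
      have "?F y < ?F x + \<eta>"
        using lt[of "F y - F x"] that by (cases \<eta>) auto
      with that have "1 \<le> ereal (\<phi>' (F y - F x)) * edist_to 0 (limiting_subdiff ?F y)"
        using KL[of y] \<rho> by auto
      also have "\<dots> \<le> ereal (\<phi>' (F y - F x)) * ereal (norm v)"
      proof (rule ereal_mult_left_mono)
        show "edist_to 0 (limiting_subdiff ?F y) \<le> ereal (norm v)"
          unfolding edist_to_def using INF_lower[OF v, of "\<lambda>v. ereal (norm (0 - v))"] by simp
        show "0 \<le> ereal (\<phi>' (F y - F x))"
          using that S pos[of "F y - F x"] by auto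
      qed
      finally show ?thesis by (simp add: one_ereal_def)
    qed
  qed
qed

text \<open>A recursive estimate that is valid only while the sequence stays in a ball bounds the length of the
path, and if the sequence starts close enough to the centre, this bound prevents it from ever
leaving the ball. Summing the estimate and cancelling one copy of \<open>\<Sum> d\<close> on both sides shows
that the path after the first step has length at most \<open>d 0 + p 0\<close>.\<close>

lemma summable_steps_if_trapped:
  fixes w :: "nat \<Rightarrow> 'a::real_normed_vector" and p :: "nat \<Rightarrow> real"
  defines "d \<equiv> \<lambda>k. norm (w (Suc k) - w k)"
  assumes step: "\<And>k. dist x (w (Suc k)) < \<rho> \<Longrightarrow> 2 * d (Suc k) \<le> d k + (p k - p (Suc k))"
    and p: "\<And>k. 0 \<le> p k"
    and start: "dist x (w (Suc 0)) + d 0 + p 0 < \<rho>"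
  shows "summable d"
proof -
  have d: "0 \<le> d k" for k by (simp add: d_def)
  have inv: "dist x (w (Suc n)) \<le> dist x (w (Suc 0)) + (\<Sum>k<n. d (Suc k)) \<and>
      (\<Sum>k<n. d (Suc k)) + d n + p n \<le> d 0 + p 0" for n
  proof (induction n)
    case 0
    show ?case by simp
  next
    case (Suc n)
    then have "dist x (w (Suc n)) < \<rho>"
      using start d[of n] p[of n] by linarith
    from step[OF this] Suc
    have "(\<Sum>k<Suc n. d (Suc k)) + d (Suc n) + p (Suc n) \<le> d 0 + p 0"
      by simp
    moreover have "dist x (w (Suc (Suc n))) \<le> dist x (w (Suc n)) + d (Suc n)"
      unfolding d_def by (metis dist_commute dist_norm dist_triangle)
    ultimately show ?case using Suc by simp
  qed
  have "(\<Sum>k<n. d (Suc k)) \<le> d 0 + p 0" for n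
    using inv[of n] d[of n] p[of n] by linarith
  then have "summable (\<lambda>k. d (Suc k))"
    using d by (intro summableI_nonneg_bounded)
  then show ?thesis by (simp add: summable_Suc_iff)
qed

text \<open>Here \<open>s\<close> and \<open>t\<close> are two consecutive step lengths, \<open>c\<close> is the slope of the desingularizing
function and \<open>\<delta>\<close> its decrease. Together the hypotheses give \<open>s\<^sup>2 \<le> t \<cdot> (b / a) \<delta>\<close>, and the
geometric mean is at most the arithmetic mean.\<close>

lemma descent_step_am_gm:
  fixes s t :: real
  assumes "0 < a" "0 < b" "0 \<le> t" "1 \<le> c * (b * t)" "c * (a * s\<^sup>2) \<le> \<delta>"
  shows "2 * s \<le> t + b / a * \<delta>"
proof -
  have "t > 0" using assms(3,4) by (cases "t = 0") auto
  have "s\<^sup>2 \<le> (c * (b * t)) * s\<^sup>2"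
    using mult_right_mono[OF assms(4), of "s\<^sup>2"] by simp
  also have "\<dots> = (b * t / a) * (c * (a * s\<^sup>2))"
    using assms(1) by simp
  also have "\<dots> \<le> (b * t / a) * \<delta>"
    using assms \<open>t > 0\<close> by (intro mult_left_mono) auto
  finally have "s\<^sup>2 \<le> t * (b / a * \<delta>)" by (simp add: ac_simps)
  moreover have "2 * s * t \<le> t\<^sup>2 + s\<^sup>2"
    using zero_le_power2[of "s - t"] by (simp add: power2_diff)
  ultimately have "t * (2 * s) \<le> t * (t + b / a * \<delta>)"
    by (simp add: power2_eq_square algebra_simps)
  with \<open>t > 0\<close> show ?thesis by (simp only: mult_le_cancel_left_pos)
qed

text \<open>Boundedness yields a cluster point \<open>x\<close>. By sufficient decrease the steps tend to zero, hence so do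
the subgradients, and \<open>x\<close> is critical; in particular the Kurdyka-Lojasiewicz property is available
at \<open>x\<close>. With \<open>e\<^sub>k = F(w\<^sub>k) - F(x)\<close> it says that \<open>\<phi>'(e\<^sub>k)\<close> is at least the reciprocal of
\<open>b \<parallel>w\<^sub>k - w\<^sub>k\<^sub>-\<^sub>1\<parallel>\<close>, while concavity of \<open>\<phi>\<close> bounds \<open>\<phi>'(e\<^sub>k) a \<parallel>w\<^sub>k\<^sub>+\<^sub>1 - w\<^sub>k\<parallel>\<^sup>2\<close> by the decrease of
\<open>\<phi>(e\<^sub>k)\<close>. Multiplying the two gives the recursive estimate of the trapping lemma, so the path has
finite length, the sequence converges, and its limit must be the cluster point.\<close>

theorem KL_descent_converges:
  fixes F :: "'a::euclidean_space \<Rightarrow> real" and w :: "nat \<Rightarrow> 'a"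
  assumes cont: "continuous_on UNIV F"
    and a: "a > 0"
    and descent: "\<And>k. F (w (Suc k)) + a * (norm (w (Suc k) - w k))\<^sup>2 \<le> F (w k)"
    and subgrad: "\<And>k. \<exists>u\<in>frechet_subdiff (\<lambda>x. ereal (F x)) (w (Suc k)). norm u \<le> b * norm (w (Suc k) - w k)"
    and bounded: "bounded (range w)"
    and KL: "\<And>x. x \<in> dom_subdiff (\<lambda>x. ereal (F x)) \<Longrightarrow> KL_property_at (\<lambda>x. ereal (F x)) x"
  shows "summable (\<lambda>k. norm (w (Suc k) - w k)) \<and>
    (\<exists>x. w \<longlonglongrightarrow> x \<and> critical_point (\<lambda>x. ereal (F x)) x)"
proof -
  let ?F = "\<lambda>x. ereal (F x)"
  define d where "d k = norm (w (Suc k) - w k)" for k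
  have d_nonneg: "0 \<le> d k" for k by (simp add: d_def)
  obtain u where u: "\<And>k. u k \<in> frechet_subdiff ?F (w (Suc k))" and u_le: "\<And>k. norm (u k) \<le> b * d k"
    using subgrad unfolding d_def by metis
  \<comment> \<open>enlarged to be positive, because the weight \<open>B / a\<close> in \<open>p\<close> below has to be\<close>
  define B where "B = max b 1"
  have "B > 0" by (simp add: B_def)
  have u_le': "norm (u k) \<le> B * d k" for k
    using u_le[of k] mult_right_mono[OF _ d_nonneg[of k], of b B] by (simp add: B_def)

  have F_step: "F (w (Suc k)) + a * (d k)\<^sup>2 \<le> F (w k)" for k
    using descent by (simp add: d_def)
  have "0 \<le> a * (d k)\<^sup>2" for k
    using a by simp
  then have "F (w (Suc k)) \<le> F (w k)" for k
    using F_step[of k] by (smt (verit))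
  then have dec: "decseq (\<lambda>k. F (w k))" by (intro decseq_SucI)

  obtain x \<sigma> where \<sigma>: "strict_mono \<sigma>" and lim_\<sigma>: "(w \<circ> \<sigma>) \<longlonglongrightarrow> x"
    using bounded_imp_convergent_subsequence[OF bounded] by blast
  have F_lim_\<sigma>: "((\<lambda>k. F (w k)) \<circ> \<sigma>) \<longlonglongrightarrow> F x"
    using continuous_on_tendsto_compose[OF cont lim_\<sigma>] by (simp add: o_def)
  have ge: "F x \<le> F (w k)" for k
  proof (rule LIMSEQ_le_const2[OF F_lim_\<sigma>])
    show "\<exists>N. \<forall>n\<ge>N. ((\<lambda>k. F (w k)) \<circ> \<sigma>) n \<le> F (w k)"
      using decseqD[OF dec] strict_mono_imp_increasing[OF \<sigma>]
      by (metis comp_apply dual_order.trans)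
  qed
  have F_lim: "(\<lambda>k. F (w k)) \<longlonglongrightarrow> F x"
  proof -
    obtain L where "(\<lambda>k. F (w k)) \<longlonglongrightarrow> L"
      using decseq_convergent[OF dec] ge by metis
    then show ?thesis
      using LIMSEQ_subseq_LIMSEQ[OF _ \<sigma>] F_lim_\<sigma> LIMSEQ_unique by metis
  qed
  have d_lim: "d \<longlonglongrightarrow> 0"
  proof -
    have "(\<lambda>k. (F (w k) - F (w (Suc k))) / a) \<longlonglongrightarrow> (F x - F x) / a"
      by (intro tendsto_intros F_lim LIMSEQ_Suc[OF F_lim]) (use a in auto)
    then have "(\<lambda>k. (F (w k) - F (w (Suc k))) / a) \<longlonglongrightarrow> 0" by simp
    moreover have "\<forall>k. norm ((d k)\<^sup>2) \<le> (F (w k) - F (w (Suc k))) / a"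
      using F_step a by (simp add: field_simps)
    ultimately have "(\<lambda>k. (d k)\<^sup>2) \<longlonglongrightarrow> 0"
      by (rule Lim_null_comparison[OF always_eventually, rotated])
    then have "(\<lambda>k. sqrt ((d k)\<^sup>2)) \<longlonglongrightarrow> sqrt 0"
      by (rule tendsto_real_sqrt)
    then show ?thesis using d_nonneg by simp
  qed
  have d_lim_\<sigma>: "(\<lambda>n. d (\<sigma> n)) \<longlonglongrightarrow> 0"
    using LIMSEQ_subseq_LIMSEQ[OF d_lim \<sigma>] by (simp add: o_def)
  have w_lim_\<sigma>: "(\<lambda>n. w (Suc (\<sigma> n))) \<longlonglongrightarrow> x"
  proof -
    have "(\<lambda>n. w (Suc (\<sigma> n)) - w (\<sigma> n)) \<longlonglongrightarrow> 0"
      using d_lim_\<sigma> unfolding d_def by (rule tendsto_norm_zero_cancel)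
    from tendsto_add[OF this lim_\<sigma>] show ?thesis by (simp add: o_def)
  qed
  have F_lim_Suc: "(\<lambda>n. F (w (Suc (\<sigma> n)))) \<longlonglongrightarrow> F x"
    using continuous_on_tendsto_compose[OF cont w_lim_\<sigma>] by simp
  have crit: "critical_point ?F x"
  proof -
    have "(\<lambda>n. B * d (\<sigma> n)) \<longlonglongrightarrow> 0"
      using tendsto_mult_right_zero[OF d_lim_\<sigma>] .
    then have "(\<lambda>n. u (\<sigma> n)) \<longlonglongrightarrow> 0"
      by (rule Lim_null_comparison[OF always_eventually, rotated]) (simp add: u_le')
    then show ?thesis
      unfolding critical_point_def limiting_subdiff_def mem_Collect_eq
      using w_lim_\<sigma> F_lim_Suc u
      by (intro conjI exI[of _ "\<lambda>n. w (Suc (\<sigma> n))"] exI[of _ "\<lambda>n. u (\<sigma> n)"]) auto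
  qed

  have summable: "summable d"
  \<comment> \<open>if the limit value is attained, the sequence is stationary from then on;
      otherwise \<open>\<phi>\<close> is only evaluated at positive arguments\<close>
  proof (cases "\<exists>m. F (w m) = F x")
    case True
    then obtain m where m: "F (w m) = F x" by blast
    have "d k = 0" if "m \<le> k" for k
    proof -
      have "F (w k) = F x" using decseqD[OF dec that] ge[of k] m by simp
      then have "a * (d k)\<^sup>2 \<le> 0" using F_step[of k] ge[of "Suc k"] by simp
      with a show ?thesis by (simp add: mult_le_0_iff)
    qed
    then show ?thesis
      by (intro summable_finite[of "{..<m}"]) auto
  next
    case False
    with ge have gt: "F x < F (w k)" for k
      by (metis order_le_less)
    have x_dom: "x \<in> dom_subdiff ?F"
      using crit by (auto simp: critical_point_def dom_subdiff_def)
    obtain \<rho> \<eta> \<phi> \<phi>' where "\<rho> > 0" "\<eta> > 0" and \<phi>_lim: "(\<phi> \<longlongrightarrow> 0) (at_right 0)"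
      and \<phi>_nonneg: "\<And>t. 0 < t \<Longrightarrow> t < \<eta> \<Longrightarrow> 0 \<le> \<phi> t"
      and tangent: "\<And>s t. 0 < s \<Longrightarrow> s < \<eta> \<Longrightarrow> 0 < t \<Longrightarrow> t < \<eta> \<Longrightarrow> \<phi> s \<le> \<phi> t + \<phi>' t * (s - t)"
      and KL_ineq: "\<And>y v. dist x y < \<rho> \<Longrightarrow> F x < F y \<Longrightarrow> F y < F x + \<eta> \<Longrightarrow>
         v \<in> limiting_subdiff ?F y \<Longrightarrow> 1 \<le> \<phi>' (F y - F x) * norm v"
      by (rule KL_property_real[OF KL[OF x_dom]]) (rule that; assumption)
    define e where "e k = F (w k) - F x" for k
    have e_pos: "0 < e k" for k using gt by (simp add: e_def)
    define p where "p k = B / a * \<phi> (e (Suc k))" for k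

    have e_lim: "(\<lambda>n. e (Suc (\<sigma> n))) \<longlonglongrightarrow> 0"
      using F_lim_Suc unfolding e_def by (rule LIM_zero)
    then have "filterlim (\<lambda>n. e (Suc (\<sigma> n))) (at_right 0) sequentially"
      using e_pos by (intro tendsto_imp_filterlim_at_right) auto
    then have "(\<lambda>n. \<phi> (e (Suc (\<sigma> n)))) \<longlonglongrightarrow> 0"
      by (rule filterlim_compose[OF \<phi>_lim])
    then have "(\<lambda>n. p (\<sigma> n)) \<longlonglongrightarrow> 0"
      unfolding p_def by (rule tendsto_mult_right_zero)
    moreover have "(\<lambda>n. dist x (w (Suc (\<sigma> n)))) \<longlonglongrightarrow> 0"
      using tendsto_dist[OF tendsto_const w_lim_\<sigma>, of x] by simp
    ultimately have "(\<lambda>n. dist x (w (Suc (\<sigma> n))) + d (\<sigma> n) + p (\<sigma> n)) \<longlonglongrightarrow> 0 + 0 + 0"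
      by (intro tendsto_add d_lim_\<sigma>)
    then have "\<forall>\<^sub>F n in sequentially. dist x (w (Suc (\<sigma> n))) + d (\<sigma> n) + p (\<sigma> n) < \<rho>"
      using \<open>\<rho> > 0\<close> by (intro order_tendstoD(2)) auto
    moreover have "\<forall>\<^sub>F n in sequentially. e (Suc (\<sigma> n)) < \<eta>"
      using e_lim \<open>\<eta> > 0\<close> by (rule order_tendstoD(2))
    ultimately obtain n where n: "dist x (w (Suc (\<sigma> n))) + d (\<sigma> n) + p (\<sigma> n) < \<rho>" "e (Suc (\<sigma> n)) < \<eta>"
      using eventually_happens'[OF sequentially_bot eventually_conj] by blast
    \<comment> \<open>from time \<open>m\<close> on, the trapping lemma applies\<close>
    define m where "m = \<sigma> n"
    have e_less: "e (Suc (m + k)) < \<eta>" for k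
      using n(2) decseqD[OF dec, of "Suc m" "Suc (m + k)"] by (simp add: e_def m_def)
    have "summable (\<lambda>k. norm (w (m + Suc k) - w (m + k)))"
    proof (rule summable_steps_if_trapped[of x "\<lambda>k. w (m + k)" \<rho> "\<lambda>k. p (m + k)"])
      show "dist x (w (m + Suc 0)) + norm (w (m + Suc 0) - w (m + 0)) + p (m + 0) < \<rho>"
        using n(1) by (simp add: m_def d_def)
      show "0 \<le> p (m + k)" for k
        unfolding p_def using e_pos e_less \<open>B > 0\<close> a \<phi>_nonneg by simp
      show "2 * norm (w (m + Suc (Suc k)) - w (m + Suc k))
          \<le> norm (w (m + Suc k) - w (m + k)) + (p (m + k) - p (m + Suc k))"
        if near: "dist x (w (m + Suc k)) < \<rho>" for k
      proof -
        define j where "j = m + k"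
        define c where "c = \<phi>' (e (Suc j))"
        have e_j: "e (Suc j) < \<eta>" "e (Suc (Suc j)) < \<eta>"
          using e_less[of k] e_less[of "Suc k"] by (simp_all add: j_def)
        have "u j \<in> limiting_subdiff ?F (w (Suc j))"
          unfolding limiting_subdiff_def mem_Collect_eq using u[of j]
          by (intro conjI exI[of _ "\<lambda>_. w (Suc j)"] exI[of _ "\<lambda>_. u j"]) auto
        then have c: "1 \<le> c * norm (u j)"
          using KL_ineq[of "w (Suc j)" "u j"] near gt[of "Suc j"] e_j(1)
          by (simp add: c_def e_def j_def)
        have "c > 0"
        proof (rule ccontr)
          assume "\<not> c > 0"
          then have "c * norm (u j) \<le> 0" by (simp add: mult_nonpos_nonneg)
          with c show False by simp
        qed
        have 1: "1 \<le> c * (B * d j)"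
          using c mult_left_mono[OF u_le'[of j], of c] \<open>c > 0\<close> by linarith
        have "c * (a * (d (Suc j))\<^sup>2) \<le> c * (e (Suc j) - e (Suc (Suc j)))"
          using F_step[of "Suc j"] \<open>c > 0\<close> by (intro mult_left_mono) (auto simp: e_def)
        also have "\<dots> \<le> \<phi> (e (Suc j)) - \<phi> (e (Suc (Suc j)))"
          using tangent[OF e_pos e_j(2) e_pos e_j(1)] by (simp add: c_def algebra_simps)
        finally have "2 * d (Suc j) \<le> d j + B / a * (\<phi> (e (Suc j)) - \<phi> (e (Suc (Suc j))))"
          using descent_step_am_gm[OF a \<open>B > 0\<close> d_nonneg 1] by blast
        then show ?thesis
          by (simp add: d_def p_def j_def right_diff_distrib)
      qed
    qed
    then have "summable (\<lambda>k. d (k + m))"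
      by (simp add: d_def add.commute)
    then show ?thesis by (simp only: summable_iff_shift)
  qed

  have "summable (\<lambda>k. w (Suc k) - w k)"
    using summable unfolding d_def by (rule summable_norm_cancel)
  then have "convergent w"
    unfolding summable_iff_convergent sum_lessThan_telescope
    using convergent_add[OF _ convergent_const[of "w 0"]] by fastforce
  then obtain x' where x': "w \<longlonglongrightarrow> x'" by (auto simp: convergent_def)
  have "x' = x"
    using LIMSEQ_unique[OF LIMSEQ_subseq_LIMSEQ[OF x' \<sigma>] lim_\<sigma>] .
  with x' crit summable show ?thesis unfolding d_def by blast
qed

section \<open>Growth of the surrogate gap and linearisation of the penalty\<close>

text \<open>Compare the minimal value with the one at \<open>t y + (1 - t) x\<close>, divide by \<open>t\<close>, and let \<open>t\<close> tend to
\<open>0\<close>. Applied to the gap between a surrogate and \<open>f\<close>, which is minimal where the two touch, this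
is the source of sufficient decrease.\<close>

lemma strongly_convex_quadratic_growth:
  assumes sc: "strongly_convex \<gamma> h" and min: "\<And>y. h x \<le> h y"
  shows "h x + \<gamma> / 2 * (norm (y - x))\<^sup>2 \<le> h y"
proof -
  have "h x + \<gamma> / 2 * (1 - t) * (norm (y - x))\<^sup>2 \<le> h y" if "t \<in> {0<..<1}" for t
  proof -
    have "h x \<le> t * h y + (1 - t) * h x - \<gamma> / 2 * t * (1 - t) * (norm (y - x))\<^sup>2"
      using sc min[of "t *\<^sub>R y + (1 - t) *\<^sub>R x"] that
      unfolding strongly_convex_def by (meson atLeastAtMost_iff greaterThanLessThan_iff less_imp_le order_trans)
    then have "t * (h x + \<gamma> / 2 * (1 - t) * (norm (y - x))\<^sup>2) \<le> t * h y"
      by (simp add: algebra_simps)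
    with that show ?thesis by (simp only: mult_le_cancel_left_pos greaterThanLessThan_iff)
  qed
  then have "\<forall>\<^sub>F t in at_right 0. h x + \<gamma> / 2 * (1 - t) * (norm (y - x))\<^sup>2 \<le> h y"
    by (intro eventually_at_rightI[of 0 1]) auto
  moreover have "((\<lambda>t. h x + \<gamma> / 2 * (1 - t) * (norm (y - x))\<^sup>2) \<longlongrightarrow>
      h x + \<gamma> / 2 * (1 - 0) * (norm (y - x))\<^sup>2) (at_right 0)"
    by (intro tendsto_intros)
  ultimately show ?thesis
    using tendsto_upperbound[of _ _ "at_right (0::real)" "h y"] by fastforce
qed

lemma concave_deriv_le_deriv_zero:
  fixes \<zeta> :: "real \<Rightarrow> real"
  assumes conc: "concave_on {0..} \<zeta>"
    and deriv: "\<And>t. 0 \<le> t \<Longrightarrow> (\<zeta> has_real_derivative \<zeta>' t) (at t within {0..})"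
    and s: "0 \<le> s"
  shows "\<zeta>' s \<le> \<zeta>' 0"
proof (cases "s = 0")
  case False
  have "\<zeta> s \<le> \<zeta> 0 + \<zeta>' 0 * (s - 0)" "\<zeta> 0 \<le> \<zeta> s + \<zeta>' s * (0 - s)"
    by (intro concave_on_below_tangent[OF conc] deriv; use s in simp)+
  then have "\<zeta>' s * s \<le> \<zeta>' 0 * s" by simp
  with False s show ?thesis by (simp only: mult_le_cancel_right_pos)
qed simp

lemma reg_le_linearized_reg:
  assumes conc: "concave_on {0..} \<zeta>"
    and deriv: "\<And>t. 0 \<le> t \<Longrightarrow> (\<zeta> has_real_derivative \<zeta>' t) (at t within {0..})"
  shows "(\<Sum>i\<in>UNIV. \<zeta> \<bar>x $ i\<bar>) \<le> linearized_reg \<zeta> \<zeta>' z x"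
  unfolding linearized_reg_def
  by (intro sum_mono concave_on_below_tangent[OF conc] deriv) auto

text \<open>The gap between the penalty and its linearisation is again separable, with the coordinate functions
\<open>g i \<bar>y $ i\<bar>\<close>, where \<open>g i\<close> is \<open>\<zeta>\<close> minus its tangent at \<open>\<bar>z $ i\<bar>\<close>. Its slope at \<open>\<bar>x $ i\<bar>\<close> is
\<open>\<zeta>' \<bar>x $ i\<bar> - \<zeta>' \<bar>z $ i\<bar>\<close>, which the Lipschitz condition makes small. At a coordinate with
\<open>x $ i = 0\<close> the slope is nonnegative because \<open>\<zeta>'\<close> is largest at \<open>0\<close>, so the kink there is harmless.\<close>

lemma linearization_gap_subgradient:
  fixes x z :: "real ^ 'n"
  assumes conc: "concave_on {0..} \<zeta>"
    and deriv: "\<And>t. 0 \<le> t \<Longrightarrow> (\<zeta> has_real_derivative \<zeta>' t) (at t within {0..})"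
    and lip: "\<And>s t. 0 \<le> s \<Longrightarrow> 0 \<le> t \<Longrightarrow> \<bar>\<zeta>' s - \<zeta>' t\<bar> \<le> L * \<bar>s - t\<bar>"
  obtains v where "frechet_subgradient (\<lambda>y. (\<Sum>i\<in>UNIV. \<zeta> \<bar>y $ i\<bar>) - linearized_reg \<zeta> \<zeta>' z y) x v"
    and "norm v \<le> \<bar>L\<bar> * norm (x - z)"
proof -
  define D where "D i = \<zeta>' \<bar>x $ i\<bar> - \<zeta>' \<bar>z $ i\<bar>" for i
  define v where "v = (\<chi> i. D i * sgn (x $ i))"
  define g where "g i s = \<zeta> s - (\<zeta> \<bar>z $ i\<bar> + \<zeta>' \<bar>z $ i\<bar> * (s - \<bar>z $ i\<bar>))" for i s
  have "frechet_subgradient (\<lambda>s. g i \<bar>s\<bar>) (x $ i) (v $ i)" for i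
  proof -
    have "(g i has_real_derivative D i) (at \<bar>x $ i\<bar> within {0..})"
      unfolding g_def D_def by (auto intro!: derivative_eq_intros deriv)
    moreover have "0 \<le> D i" if "x $ i = 0"
      unfolding D_def using concave_deriv_le_deriv_zero[OF conc deriv, of "\<bar>z $ i\<bar>"] that by simp
    ultimately have "frechet_subgradient (\<lambda>s. g i \<bar>s\<bar>) (x $ i) (D i * sgn (x $ i))"
      by (rule frechet_subgradient_abs)
    then show ?thesis by (simp add: v_def)
  qed
  then have "frechet_subgradient (\<lambda>y. \<Sum>i\<in>UNIV. g i \<bar>y $ i\<bar>) x v"
    by (rule frechet_subgradient_separable)
  then have 1: "frechet_subgradient (\<lambda>y. (\<Sum>i\<in>UNIV. \<zeta> \<bar>y $ i\<bar>) - linearized_reg \<zeta> \<zeta>' z y) x v"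
    by (simp add: g_def linearized_reg_def sum_subtractf)
  have "norm (v $ i) \<le> norm ((L *\<^sub>R (x - z)) $ i)" for i
  proof -
    have "norm (v $ i) \<le> \<bar>D i\<bar>"
      by (simp add: v_def abs_mult sgn_if)
    also have "\<dots> \<le> L * \<bar>\<bar>x $ i\<bar> - \<bar>z $ i\<bar>\<bar>"
      unfolding D_def by (rule lip) auto
    also have "\<dots> \<le> \<bar>L\<bar> * \<bar>x $ i - z $ i\<bar>"
      by (intro mult_mono abs_triangle_ineq3) auto
    finally show ?thesis by (simp add: abs_mult)
  qed
  then have "norm v \<le> norm (L *\<^sub>R (x - z))"
    by (rule norm_le_componentwise_cart)
  then have "norm v \<le> \<bar>L\<bar> * norm (x - z)" by simp
  with 1 show thesis by (rule that)
qed

section \<open>Convergence of the majorization-minimization schemes\<close>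

theorem theorem18:
  fixes f r F :: "real ^ 'n \<Rightarrow> real"
    and gradf :: "real ^ 'n \<Rightarrow> real ^ 'n"
    and \<zeta> \<zeta>' :: "real \<Rightarrow> real"
    and w :: "nat \<Rightarrow> real ^ 'n"
    and Qf :: "nat \<Rightarrow> real ^ 'n \<Rightarrow> real"
    and gradQ :: "nat \<Rightarrow> real ^ 'n \<Rightarrow> real ^ 'n"
    and L\<^sub>f L\<^sub>\<zeta> L\<^sub>Q \<gamma> :: real
  assumes f_nonneg: "\<And>x. 0 \<le> f x"
    and F_def: "F = (\<lambda>x. f x + r x)"
    and A1_grad: "\<And>u. GDERIV f u :> gradf u"
    and A1_pos: "L\<^sub>f > 0"
    and A1_lip: "\<And>u v. norm (gradf u - gradf v) \<le> L\<^sub>f * norm (u - v)"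
    and A2_lsc: "lower_semicontinuous (\<lambda>x. ereal (F x))"
    and A2_coercive: "filterlim F at_top at_infinity"
    and A2_bdd: "bdd_below (range F)"
    and A3_r: "r = (\<lambda>x. \<Sum>i\<in>UNIV. \<zeta> \<bar>x $ i\<bar>)"
    and A3_nonneg: "\<And>t. 0 \<le> t \<Longrightarrow> 0 \<le> \<zeta> t"
    and A3_concave: "concave_on {0..} \<zeta>"
    and A3_deriv: "\<And>t. 0 \<le> t \<Longrightarrow> (\<zeta> has_real_derivative \<zeta>' t) (at t within {0..})"
    and A3_lip: "\<And>s t. 0 \<le> s \<Longrightarrow> 0 \<le> t \<Longrightarrow> \<bar>\<zeta>' s - \<zeta>' t\<bar> \<le> L\<^sub>\<zeta> * \<bar>s - t\<bar>"
    and A4_major: "\<And>k x. f x \<le> Qf k x"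
    and A4_touch: "\<And>k. Qf k (w k) = f (w k)"
    and A4_gamma: "\<gamma> > 0"
    and A4_strong: "\<And>k. strongly_convex \<gamma> (\<lambda>x. Qf k x - f x)"
    and A4_grad: "\<And>k x. GDERIV (Qf k) x :> gradQ k x"
    and A4_lip: "\<And>k. L\<^sub>Q-lipschitz_on UNIV (gradQ k)"
    and A4_grad_eq: "\<And>k. gradQ k (w k) = gradf (w k)"
    and A5: "(\<forall>k. is_arg_min (\<lambda>x. Qf k x + r x) (\<lambda>x. True) (w (Suc k))) \<or>
             (\<forall>k. is_arg_min (\<lambda>x. Qf k x + linearized_reg \<zeta> \<zeta>' (w k) x) (\<lambda>x. True) (w (Suc k)))"
    and A6: "\<And>x. x \<in> dom_subdiff (\<lambda>x. ereal (F x)) \<Longrightarrow> KL_property_at (\<lambda>x. ereal (F x)) x"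
  shows "summable (\<lambda>k. norm (w (Suc k) - w k)) \<and>
         (\<exists>ws. w \<longlonglongrightarrow> ws \<and> critical_point (\<lambda>x. ereal (F x)) ws)"
proof -
  \<comment> \<open>both schemes minimise \<open>Qf k + R\<close> for some
      majorant \<open>R\<close> of \<open>r\<close>: either \<open>r\<close> itself or its linearisation\<close>
  have reg_majorant: "\<exists>R v. (\<forall>x. r x \<le> R x) \<and> R (w k) = r (w k) \<and>
      (\<forall>x. Qf k (w (Suc k)) + R (w (Suc k)) \<le> Qf k x + R x) \<and>
      frechet_subgradient (\<lambda>x. r x - R x) (w (Suc k)) v \<and>
      norm v \<le> \<bar>L\<^sub>\<zeta>\<bar> * norm (w (Suc k) - w k)" for k
    using A5
  proof
    assume "\<forall>k. is_arg_min (\<lambda>x. Qf k x + r x) (\<lambda>x. True) (w (Suc k))"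
    then have "\<forall>x. Qf k (w (Suc k)) + r (w (Suc k)) \<le> Qf k x + r x"
      by (simp add: is_arg_min_linorder)
    moreover have "frechet_subgradient (\<lambda>x. r x - r x) (w (Suc k)) 0"
      by (rule frechet_subgradient_minimizer) simp
    ultimately show ?thesis
      by (intro exI[of _ r] exI[of _ 0]) simp
  next
    let ?R = "linearized_reg \<zeta> \<zeta>' (w k)"
    assume "\<forall>k. is_arg_min (\<lambda>x. Qf k x + linearized_reg \<zeta> \<zeta>' (w k) x) (\<lambda>x. True) (w (Suc k))"
    then have min: "\<forall>x. Qf k (w (Suc k)) + ?R (w (Suc k)) \<le> Qf k x + ?R x"
      by (simp add: is_arg_min_linorder)
    obtain v where "frechet_subgradient (\<lambda>x. r x - ?R x) (w (Suc k)) v"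
        "norm v \<le> \<bar>L\<^sub>\<zeta>\<bar> * norm (w (Suc k) - w k)"
      unfolding A3_r
      by (rule linearization_gap_subgradient[OF A3_concave A3_deriv A3_lip, of "w k" "w (Suc k)"])
    moreover have "\<forall>x. r x \<le> ?R x"
      unfolding A3_r using reg_le_linearized_reg[OF A3_concave A3_deriv] by blast
    moreover have "?R (w k) = r (w k)"
      by (simp add: linearized_reg_def A3_r)
    ultimately show ?thesis using min by blast
  qed
  have step: "F (w (Suc k)) + \<gamma> / 2 * (norm (w (Suc k) - w k))\<^sup>2 \<le> F (w k) \<and>
      (\<exists>u\<in>frechet_subdiff (\<lambda>x. ereal (F x)) (w (Suc k)).
         norm u \<le> (L\<^sub>f + L\<^sub>Q + \<bar>L\<^sub>\<zeta>\<bar>) * norm (w (Suc k) - w k))" for k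
  proof -
    let ?w = "w k" and ?w' = "w (Suc k)"
    obtain R v where R: "\<And>x. r x \<le> R x" "R ?w = r ?w"
      and min: "\<And>x. Qf k ?w' + R ?w' \<le> Qf k x + R x"
      and v: "frechet_subgradient (\<lambda>x. r x - R x) ?w' v" "norm v \<le> \<bar>L\<^sub>\<zeta>\<bar> * norm (?w' - ?w)"
      using reg_majorant[of k] by blast
    have "Qf k ?w - f ?w + \<gamma> / 2 * (norm (?w' - ?w))\<^sup>2 \<le> Qf k ?w' - f ?w'"
      by (rule strongly_convex_quadratic_growth[OF A4_strong]) (simp add: A4_touch A4_major)
    then have descent: "F ?w' + \<gamma> / 2 * (norm (?w' - ?w))\<^sup>2 \<le> F ?w"
      using min[of ?w] R(1)[of ?w'] R(2) A4_touch[of k] by (simp add: F_def)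
    define u where "u = gradf ?w' - gradQ k ?w' + v"
    \<comment> \<open>the minimised function contributes the subgradient \<open>0\<close>, so only the two gaps remain\<close>
    have "frechet_subgradient (\<lambda>x. Qf k x + R x + ((f x - Qf k x) + (r x - R x))) ?w' (0 + u)"
      unfolding u_def
      by (intro frechet_subgradient_add frechet_subgradient_minimizer v min
            frechet_subgradient_GDERIV GDERIV_diff A1_grad A4_grad)
    then have "u \<in> frechet_subdiff (\<lambda>x. ereal (F x)) ?w'"
      by (intro frechet_subgradient_imp_frechet_subdiff) (simp add: F_def algebra_simps)
    moreover have "norm u \<le> (L\<^sub>f + L\<^sub>Q + \<bar>L\<^sub>\<zeta>\<bar>) * norm (?w' - ?w)"
    proof -
      \<comment> \<open>the two gradients agree at \<open>w k\<close>, so their difference at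
          the next iterate is controlled by the Lipschitz constants\<close>
      have "u = (gradf ?w' - gradf ?w) + (gradQ k ?w - gradQ k ?w') + v"
        by (simp add: u_def A4_grad_eq)
      then have "norm u \<le> norm (gradf ?w' - gradf ?w) + norm (gradQ k ?w - gradQ k ?w') + norm v"
        by (metis add_mono norm_triangle_le order_refl)
      moreover have "norm (gradQ k ?w - gradQ k ?w') \<le> L\<^sub>Q * norm (?w' - ?w)"
        using lipschitz_onD[OF A4_lip, of ?w ?w' k] by (simp add: dist_norm norm_minus_commute)
      ultimately show ?thesis
        using A1_lip[of ?w' ?w] v(2) by (simp add: algebra_simps)
    qed
    ultimately show ?thesis using descent by blast
  qed
  have cont: "continuous_on UNIV F"
  proof -
    have "continuous_on UNIV f"
      using A1_grad unfolding gderiv_def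
      by (meson continuous_at_imp_continuous_on has_derivative_continuous)
    moreover have "continuous_on {0..} \<zeta>"
      using A3_deriv by (intro DERIV_continuous_on) auto
    then have "continuous_on UNIV (\<lambda>x :: real ^ 'n. \<zeta> \<bar>x $ i\<bar>)" for i
      by (rule continuous_on_compose2) (auto intro!: continuous_intros)
    ultimately show ?thesis
      unfolding F_def A3_r by (intro continuous_intros)
  qed
  have "bounded (range w)"
  proof -
    have "decseq (\<lambda>k. F (w k))"
    proof (intro decseq_SucI)
      show "F (w (Suc k)) \<le> F (w k)" for k
      proof -
        have "0 \<le> \<gamma> / 2 * (norm (w (Suc k) - w k))\<^sup>2"
          using A4_gamma by simp
        with step[of k] show ?thesis by linarith
      qed
    qed
    then have "F (w k) \<le> F (w 0)" for k
      using decseqD by blast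
    moreover obtain B where "\<And>x. B \<le> norm x \<Longrightarrow> F (w 0) < F x"
      using A2_coercive unfolding filterlim_at_top_dense eventually_at_infinity by blast
    ultimately have "norm (w k) \<le> B" for k
      by (meson linorder_not_less nle_le)
    then show ?thesis by (auto simp: bounded_iff)
  qed
  then show ?thesis
    using KL_descent_converges[OF cont _ _ _ _ A6, of "\<gamma> / 2" w "L\<^sub>f + L\<^sub>Q + \<bar>L\<^sub>\<zeta>\<bar>"] step A4_gamma
    by simp
qed

end
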